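(* Let $(W(t))_{t\ge0}$ be standard one-dimensional Brownian motion started at $0$, let $T=\inf\{t:|W(t)|=1\}$ and $M=\sup_{t\in[0,1]}|W(t)|$, and let $\Phi(t)=\mathbb{P}(T<t)$ and $\Gamma(x)=\mathbb{P}(M<x)$. Then $$\Phi(t)=1-\Gamma\Big(\frac{1}{\sqrt t}\Big),\qquad t>0.$$ *)

theory Defs
  imports "HOL-Probability.Probability"
begin

text \<open>
  Only the values of \<open>W\<close> at nonnegative times are constrained. The second parameter of
  \<^const>\<open>normal_density\<close> is the standard deviation, so the increment over \<open>[s, t]\<close> has
  variance \<open>t - s\<close>.
\<close>

locale standard_brownian_motion = prob_space M for M :: "'a measure" +
  fixes W :: "real \<Rightarrow> 'a \<Rightarrow> real"
  assumes measurable_marginals: "0 \<le> t \<Longrightarrow> W t \<in> borel_measurable M"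
    and start_at_0: "AE \<omega> in M. W 0 \<omega> = 0"
    and independent_increments:
      "0 \<le> u 0 \<Longrightarrow> (\<And>i. i < n \<Longrightarrow> u i < u (Suc i)) \<Longrightarrow>
        indep_vars (\<lambda>_. borel) (\<lambda>i \<omega>. W (u (Suc i)) \<omega> - W (u i) \<omega>) {..<n::nat}"
    and gaussian_increments:
      "0 \<le> s \<Longrightarrow> s < t \<Longrightarrow>
        distributed M lborel (\<lambda>\<omega>. W t \<omega> - W s \<omega>) (normal_density 0 (sqrt (t - s)))"
    and continuous_paths: "AE \<omega> in M. continuous_on {0..} (\<lambda>t. W t \<omega>)"

text \<open>
  The values are extended reals: the infimum of the empty set is \<open>\<infinity>\<close>, and the supremum is
  \<open>\<infinity>\<close> on the exceptional paths that are unbounded on \<open>[0, 1]\<close>.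
\<close>

definition exit_time :: "(real \<Rightarrow> 'a \<Rightarrow> real) \<Rightarrow> 'a \<Rightarrow> ereal" where
  "exit_time W \<omega> = (INF t\<in>{t. 0 \<le> t \<and> \<bar>W t \<omega>\<bar> = 1}. ereal t)"

definition max_abs :: "(real \<Rightarrow> 'a \<Rightarrow> real) \<Rightarrow> 'a \<Rightarrow> ereal" where
  "max_abs W \<omega> = (SUP t\<in>{0..1}. ereal \<bar>W t \<omega>\<bar>)"

text \<open>
  Since paths are only almost surely continuous, the events below are measurable up to null
  sets, so their probabilities are taken in the completion of \<open>M\<close>. The completion agrees
  with \<open>M\<close> on every set that is measurable in \<open>M\<close>.
\<close>

definition \<Phi> :: "'a measure \<Rightarrow> (real \<Rightarrow> 'a \<Rightarrow> real) \<Rightarrow> real \<Rightarrow> real" where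
  "\<Phi> M W t = measure (completion M) {\<omega> \<in> space M. exit_time W \<omega> < ereal t}"

definition \<Gamma> :: "'a measure \<Rightarrow> (real \<Rightarrow> 'a \<Rightarrow> real) \<Rightarrow> real \<Rightarrow> real" where
  "\<Gamma> M W x = measure (completion M) {\<omega> \<in> space M. max_abs W \<omega> < ereal x}"

end

theory Submission imports Defs begin

text \<open>
  By Brownian scaling, \<open>B s = W (t * s) / sqrt t\<close> is again a standard Brownian motion. Up to
  time \<open>t\<close> a path of \<open>W\<close> reaches absolute value \<open>1\<close> exactly when the corresponding path of
  \<open>B\<close> reaches absolute value \<open>1 / sqrt t\<close> within \<open>[0, 1]\<close>; by continuity and compactness this
  means that the maximum of \<open>\<bar>B\<bar>\<close> is at least \<open>1 / sqrt t\<close>. The event \<open>T < t\<close> demands that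
  the level be reached strictly before \<open>t\<close>, which makes no difference because
  \<open>\<bar>W t\<bar> = 1\<close> has probability zero. Hence \<open>\<Phi> M W t = 1 - \<Gamma> M B (1 / sqrt t)\<close>
  (lemma \<open>\<Phi>_eq_one_minus_\<Gamma>_rescaled\<close>).

  It remains to replace \<open>B\<close> by \<open>W\<close>, that is, to see that \<open>\<Gamma>\<close> is the same for every standard
  Brownian motion (lemma \<open>\<Gamma>_unique\<close>). For a continuous path the event \<open>max_abs W < x\<close> is an
  increasing union over \<open>m\<close> of decreasing intersections over \<open>n\<close> of the events that
  \<open>\<bar>W\<bar> \<le> x - 1 / (m + 1)\<close> on the dyadic grid of mesh \<open>1 / 2 ^ n\<close>. Such a grid event depends
  only on finitely many increments, whose joint law is a product of normal laws.
\<close>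

section \<open>Events of a completed measure\<close>

text \<open>
  Events about continuous paths are described by countably many times only outside a null
  set; the completion is what makes them measurable there.
\<close>

lemma measure_completion_AE_eq:
  assumes P: "{x \<in> space M. P x} \<in> sets M"
    and eq: "AE x in M. P x \<longleftrightarrow> Q x"
  shows "measure (completion M) {x \<in> space M. Q x} = measure M {x \<in> space M. P x}"
proof -
  have [measurable]: "Measurable.pred (completion M) P"
    using P by (simp add: pred_def)
  have "AE x in M. \<not> (P x \<noteq> Q x)" using eq by auto
  from sets_completion_AE[OF this]
  have [measurable]: "Measurable.pred (completion M) (\<lambda>x. P x \<noteq> Q x)" .
  have "Measurable.pred (completion M) (\<lambda>x. P x \<noteq> (P x \<noteq> Q x))"
    by measurable
  moreover have "(\<lambda>x. P x \<noteq> (P x \<noteq> Q x)) = Q" by auto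
  ultimately have Q: "Measurable.pred (completion M) Q" by simp
  then have sets: "{x \<in> space M. Q x} \<in> sets (completion M)"
    by (simp add: pred_def)
  have "measure (completion M) {x \<in> space M. Q x} = measure (completion M) {x \<in> space M. P x}"
  proof (rule measure_eq_AE)
    show "AE x in completion M. x \<in> {x \<in> space M. Q x} \<longleftrightarrow> x \<in> {x \<in> space M. P x}"
      using AE_completion[OF eq] by eventually_elim auto
  qed (use P sets in auto)
  with P show "measure (completion M) {x \<in> space M. Q x} = measure M {x \<in> space M. P x}"
    by simp
qed

section \<open>Continuous paths\<close>

lemma le_on_unit_interval_if_le_on_dyadics:
  fixes g :: "real \<Rightarrow> real"
  assumes cont: "continuous_on {0..1} g"
    and le: "\<And>n k. k \<le> 2 ^ n \<Longrightarrow> g (real k / 2 ^ n) \<le> c"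
    and s: "s \<in> {0..1}"
  shows "g s \<le> c"
proof -
  define k where "k n = nat \<lfloor>s * 2 ^ n\<rfloor>" for n :: nat
  define u where "u n = real (k n) / 2 ^ n" for n :: nat
  have real_k: "real (k n) = of_int \<lfloor>s * 2 ^ n\<rfloor>" for n
    using s by (simp add: k_def)
  have k_upper: "real (k n) \<le> s * 2 ^ n" and k_lower: "s * 2 ^ n - 1 \<le> real (k n)" for n
    unfolding real_k by linarith+
  have k_le: "k n \<le> 2 ^ n" for n
  proof -
    have "s * 2 ^ n \<le> 1 * 2 ^ n" using s by (intro mult_right_mono) auto
    with k_upper[of n] have "real (k n) \<le> real (2 ^ n)"
      unfolding of_nat_power of_nat_numeral by linarith
    then show ?thesis by (simp only: of_nat_le_iff)
  qed
  have u_upper: "u n \<le> s" for n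
    using k_upper[of n] by (simp add: u_def divide_le_eq)
  have u_lower: "s - (1 / 2) ^ n \<le> u n" for n
  proof -
    have "s - (1 / 2) ^ n = (s * 2 ^ n - 1) / 2 ^ n"
      by (simp add: diff_divide_distrib power_one_over)
    also have "\<dots> \<le> u n"
      unfolding u_def using k_lower[of n] by (rule divide_right_mono) simp
    finally show ?thesis .
  qed
  have lim: "u \<longlonglongrightarrow> s"
  proof (rule tendsto_sandwich)
    show "(\<lambda>n. s - (1 / 2) ^ n) \<longlonglongrightarrow> s"
      by (rule tendsto_eq_intros LIMSEQ_realpow_zero refl | simp)+
  qed (use u_upper u_lower in auto)
  have u_in: "u n \<in> {0..1}" for n
  proof -
    have "0 \<le> u n" by (simp add: u_def)
    then show ?thesis using u_upper[of n] s by simp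
  qed
  have "(\<lambda>n. g (u n)) \<longlonglongrightarrow> g s"
    by (rule continuous_on_tendsto_compose[OF cont lim s]) (use u_in in auto)
  then show ?thesis
    by (rule LIMSEQ_le_const2) (use le k_le in \<open>auto simp: u_def\<close>)
qed

text \<open>
  Dyadic values alone would only bound the supremum by \<open>x\<close> weakly. The gap \<open>1 / (m + 1)\<close>,
  with \<open>m\<close> chosen before the grid, keeps the bound strict. Subtracting \<open>W 0 \<omega> = 0\<close> makes
  every condition one on sums of increments, so that no law has to be known for \<open>W 0\<close>.
\<close>

lemma max_abs_less_iff_dyadic:
  assumes cont: "continuous_on {0..} (\<lambda>s. W s \<omega>)" and start: "W 0 \<omega> = 0"
  shows "max_abs W \<omega> < ereal x \<longleftrightarrow>
    (\<exists>m. \<forall>n. \<forall>k\<le>2 ^ n. \<bar>W (real k / 2 ^ n) \<omega> - W 0 \<omega>\<bar> \<le> x - inverse (real (Suc m)))"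
    (is "_ \<longleftrightarrow> (\<exists>m. ?grid m)")
proof
  assume "max_abs W \<omega> < ereal x"
  then obtain y where "max_abs W \<omega> < ereal y" and "y < x"
    using ereal_dense2 by (metis less_ereal.simps(1))
  from \<open>y < x\<close> obtain m where "inverse (real (Suc m)) < x - y"
    using reals_Archimedean[of "x - y"] by auto
  have "?grid m"
  proof (intro allI impI)
    fix n k :: nat
    assume "k \<le> 2 ^ n"
    then have "real k \<le> real (2 ^ n)" by (simp only: of_nat_le_iff)
    then have "real k / 2 ^ n \<in> {0..1}" by simp
    then have "ereal \<bar>W (real k / 2 ^ n) \<omega>\<bar> \<le> max_abs W \<omega>"
      unfolding max_abs_def by (rule SUP_upper)
    also note \<open>max_abs W \<omega> < ereal y\<close>
    finally show "\<bar>W (real k / 2 ^ n) \<omega> - W 0 \<omega>\<bar> \<le> x - inverse (real (Suc m))"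
      using start \<open>inverse (real (Suc m)) < x - y\<close> by simp
  qed
  then show "\<exists>m. ?grid m" ..
next
  assume "\<exists>m. ?grid m"
  then obtain m where grid: "?grid m" ..
  have "continuous_on {0..1} (\<lambda>s. W s \<omega>)"
    using cont by (rule continuous_on_subset) auto
  then have cont_abs: "continuous_on {0..1} (\<lambda>s. \<bar>W s \<omega>\<bar>)"
    by (rule continuous_on_rabs)
  have "\<bar>W s \<omega>\<bar> \<le> x - inverse (real (Suc m))" if "s \<in> {0..1}" for s
    using cont_abs _ that
  proof (rule le_on_unit_interval_if_le_on_dyadics)
    fix n k :: nat
    assume "k \<le> 2 ^ n"
    with grid have "\<bar>W (real k / 2 ^ n) \<omega> - W 0 \<omega>\<bar> \<le> x - inverse (real (Suc m))" by blast
    then show "\<bar>W (real k / 2 ^ n) \<omega>\<bar> \<le> x - inverse (real (Suc m))" by (simp add: start)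
  qed
  then have "max_abs W \<omega> \<le> ereal (x - inverse (real (Suc m)))"
    unfolding max_abs_def by (intro SUP_least) auto
  also have "\<dots> < ereal x" by simp
  finally show "max_abs W \<omega> < ereal x" .
qed

text \<open>
  The hypothesis at time \<open>t\<close> is what turns "reached by time \<open>t\<close>" into "reached before time
  \<open>t\<close>"; without it a path that first reaches the level at time \<open>t\<close> is a counterexample.
\<close>

lemma exit_time_less_iff_max_abs_rescaled:
  assumes cont: "continuous_on {0..} (\<lambda>s. W s \<omega>)" and start: "W 0 \<omega> = 0"
    and t: "t > 0" and off: "\<bar>W t \<omega>\<bar> \<noteq> 1"
  shows "exit_time W \<omega> < ereal t \<longleftrightarrow>
    \<not> max_abs (\<lambda>s \<omega>. W (t * s) \<omega> / sqrt t) \<omega> < ereal (1 / sqrt t)"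
    (is "_ \<longleftrightarrow> \<not> max_abs ?B \<omega> < _")
proof
  assume "exit_time W \<omega> < ereal t"
  then obtain s where s: "0 \<le> s" "\<bar>W s \<omega>\<bar> = 1" "s < t"
    unfolding exit_time_def by (auto simp: INF_less_iff)
  have "s / t \<in> {0..1}" using s t by simp
  then have "ereal \<bar>?B (s / t) \<omega>\<bar> \<le> max_abs ?B \<omega>"
    unfolding max_abs_def by (rule SUP_upper)
  moreover have "\<bar>?B (s / t) \<omega>\<bar> = 1 / sqrt t"
    using s t by (simp add: abs_divide)
  ultimately show "\<not> max_abs ?B \<omega> < ereal (1 / sqrt t)" by (simp add: not_less)
next
  assume large: "\<not> max_abs ?B \<omega> < ereal (1 / sqrt t)"
  have contB: "continuous_on {0..1} (\<lambda>s. \<bar>?B s \<omega>\<bar>)"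
    using t by (intro continuous_intros continuous_on_compose2[OF cont]) auto
  \<comment> \<open>A supremum equal to \<open>1 / sqrt t\<close> must be attained for the level to be reached at all.\<close>
  obtain s where s: "s \<in> {0..1}" and max: "\<And>r. r \<in> {0..1} \<Longrightarrow> \<bar>?B r \<omega>\<bar> \<le> \<bar>?B s \<omega>\<bar>"
    using continuous_attains_sup[OF _ _ contB] by force
  have "max_abs ?B \<omega> \<le> ereal \<bar>?B s \<omega>\<bar>"
    unfolding max_abs_def using max by (intro SUP_least) auto
  with large have "ereal (1 / sqrt t) \<le> ereal \<bar>?B s \<omega>\<bar>"
    by (meson not_less order_trans)
  then have ge: "1 \<le> \<bar>W (t * s) \<omega>\<bar>"
    using t by (simp add: abs_divide divide_le_cancel)
  have ts: "0 \<le> t * s" "t * s \<le> t" using s t by (auto simp: mult_le_cancel_left1)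
  have "continuous_on {0..t * s} (\<lambda>r. \<bar>W r \<omega>\<bar>)"
    by (intro continuous_intros continuous_on_subset[OF cont]) auto
  then obtain r where r: "0 \<le> r" "r \<le> t * s" "\<bar>W r \<omega>\<bar> = 1"
    using IVT'[of "\<lambda>r. \<bar>W r \<omega>\<bar>" 0 1 "t * s"] ge start ts by auto
  have "r < t" using r ts off by (metis order_le_less order_trans)
  with r show "exit_time W \<omega> < ereal t"
    unfolding exit_time_def by (auto simp: INF_less_iff)
qed

section \<open>Uniqueness of the law of the maximum\<close>

context standard_brownian_motion
begin

lemma increments_distr_PiM:
  assumes n: "0 < n" and u: "0 \<le> u 0" "\<And>i. i < n \<Longrightarrow> u i < u (Suc i)"
  shows "distr M (\<Pi>\<^sub>M i\<in>{..<n}. borel) (\<lambda>\<omega>. \<lambda>i\<in>{..<n}. W (u (Suc i)) \<omega> - W (u i) \<omega>) =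
    (\<Pi>\<^sub>M i\<in>{..<n::nat}. density lborel (normal_density 0 (sqrt (u (Suc i) - u i))))"
proof -
  have u_nonneg: "0 \<le> u i" if "i \<le> n" for i
    using that
  proof (induction i)
    case (Suc i)
    then show ?case using u(2)[of i] by simp
  qed (use u in simp)
  have indep: "indep_vars (\<lambda>_. borel) (\<lambda>i \<omega>. W (u (Suc i)) \<omega> - W (u i) \<omega>) {..<n}"
    using u by (rule independent_increments)
  have "distr M (\<Pi>\<^sub>M i\<in>{..<n}. borel) (\<lambda>\<omega>. \<lambda>i\<in>{..<n}. W (u (Suc i)) \<omega> - W (u i) \<omega>) =
      (\<Pi>\<^sub>M i\<in>{..<n}. distr M borel (\<lambda>\<omega>. W (u (Suc i)) \<omega> - W (u i) \<omega>))"
  proof (subst indep_vars_iff_distr_eq_PiM'[symmetric])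
    fix i assume "i \<in> {..<n}"
    then show "(\<lambda>\<omega>. W (u (Suc i)) \<omega> - W (u i) \<omega>) \<in> borel_measurable M"
      using u_nonneg by (intro borel_measurable_diff measurable_marginals) auto
  qed (use n indep in auto)
  also have "\<dots> = (\<Pi>\<^sub>M i\<in>{..<n}. density lborel (normal_density 0 (sqrt (u (Suc i) - u i))))"
  proof (rule PiM_cong[OF refl])
    fix i assume "i \<in> {..<n}"
    then have "distributed M lborel (\<lambda>\<omega>. W (u (Suc i)) \<omega> - W (u i) \<omega>)
        (normal_density 0 (sqrt (u (Suc i) - u i)))"
      using u u_nonneg by (intro gaussian_increments) auto
    then have "distr M lborel (\<lambda>\<omega>. W (u (Suc i)) \<omega> - W (u i) \<omega>) =
        density lborel (normal_density 0 (sqrt (u (Suc i) - u i)))"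
      by (rule distributed_distr_eq_density)
    moreover have "distr M borel (\<lambda>\<omega>. W (u (Suc i)) \<omega> - W (u i) \<omega>) =
        distr M lborel (\<lambda>\<omega>. W (u (Suc i)) \<omega> - W (u i) \<omega>)"
      by (rule distr_cong) auto
    ultimately show "distr M borel (\<lambda>\<omega>. W (u (Suc i)) \<omega> - W (u i) \<omega>) =
        density lborel (normal_density 0 (sqrt (u (Suc i) - u i)))"
      by simp
  qed
  finally show ?thesis .
qed

text \<open>
  The values on the grid are partial sums of the increments over its cells, which are
  independent and normal with variance \<open>1 / 2 ^ n\<close>. Since the right-hand side does not mention
  \<open>M\<close> and \<open>W\<close>, the left-hand side is the same for all Brownian motions.
\<close>

lemma measure_dyadic_bound:
  "measure M {\<omega> \<in> space M. \<forall>k\<le>2 ^ n. \<bar>W (real k / 2 ^ n) \<omega> - W 0 \<omega>\<bar> \<le> y} =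
    measure (\<Pi>\<^sub>M i\<in>{..<2 ^ n}. density lborel (normal_density 0 (sqrt (1 / 2 ^ n))))
      {x \<in> space (\<Pi>\<^sub>M i\<in>{..<2 ^ n :: nat}. borel). \<forall>k\<le>2 ^ n. \<bar>\<Sum>i<k. x i\<bar> \<le> y}"
proof -
  define N :: nat where "N = 2 ^ n"
  define u :: "nat \<Rightarrow> real" where "u i = real i / 2 ^ n" for i
  define X where "X \<omega> = (\<lambda>i\<in>{..<N}. W (u (Suc i)) \<omega> - W (u i) \<omega>)" for \<omega>
  let ?P = "\<Pi>\<^sub>M i\<in>{..<N}. borel :: real measure"
  let ?E = "{x \<in> space ?P. \<forall>k\<le>N. \<bar>\<Sum>i<k. x i\<bar> \<le> y}"
  have X [measurable]: "X \<in> measurable M ?P"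
    unfolding X_def by (intro measurable_restrict borel_measurable_diff measurable_marginals)
       (auto simp: u_def)
  have coordinate: "(\<lambda>x. x i) \<in> borel_measurable ?P" if "i < N" for i
    using that by (intro measurable_component_singleton) auto
  have "(\<lambda>x. \<Sum>i<k. x i) \<in> borel_measurable ?P" if "k \<le> N" for k
    using that by (intro borel_measurable_sum coordinate) auto
  then have "{x \<in> space ?P. \<forall>k\<in>{..N}. \<bar>\<Sum>i<k. x i\<bar> \<le> y} \<in> sets ?P"
    by (intro sets.sets_Collect_finite_All' borel_measurable_le borel_measurable_abs) auto
  then have E: "?E \<in> sets ?P"
    by (simp only: Ball_def atMost_iff)
  have sum_X: "(\<Sum>i<k. X \<omega> i) = W (u k) \<omega> - W 0 \<omega>" if "k \<le> N" for k \<omega>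
  proof -
    have "(\<Sum>i<k. X \<omega> i) = (\<Sum>i<k. W (u (Suc i)) \<omega> - W (u i) \<omega>)"
      using that by (intro sum.cong) (auto simp: X_def)
    also have "\<dots> = W (u k) \<omega> - W (u 0) \<omega>" by (rule sum_lessThan_telescope)
    finally show ?thesis by (simp add: u_def)
  qed
  have "{\<omega> \<in> space M. \<forall>k\<le>N. \<bar>W (u k) \<omega> - W 0 \<omega>\<bar> \<le> y} = X -` ?E \<inter> space M"
    using measurable_space[OF X] by (auto simp: sum_X)
  then have "measure M {\<omega> \<in> space M. \<forall>k\<le>N. \<bar>W (u k) \<omega> - W 0 \<omega>\<bar> \<le> y} =
      measure (distr M ?P X) ?E"
    by (simp add: measure_distr[OF X E])
  also have "distr M ?P X = (\<Pi>\<^sub>M i\<in>{..<N}. density lborel (normal_density 0 (sqrt (1 / 2 ^ n))))"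
  proof -
    have diff: "u (Suc i) - u i = 1 / 2 ^ n" for i
      by (simp add: u_def field_simps)
    have "u i < u (Suc i)" for i by (simp add: u_def divide_strict_right_mono)
    then show ?thesis
      using increments_distr_PiM[of N u] by (simp add: N_def u_def[of 0] diff X_def[abs_def])
  qed
  finally show ?thesis by (simp add: N_def u_def)
qed

lemma measurable_dyadic_bound:
  "{\<omega> \<in> space M. \<forall>k\<le>2 ^ n. \<bar>W (real k / 2 ^ n) \<omega> - W 0 \<omega>\<bar> \<le> y} \<in> sets M"
proof -
  have "{\<omega> \<in> space M. \<forall>k\<in>{..2 ^ n}. \<bar>W (real k / 2 ^ n) \<omega> - W 0 \<omega>\<bar> \<le> y} \<in> sets M"
    by (intro sets.sets_Collect_finite_All' borel_measurable_le borel_measurable_abs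
        borel_measurable_diff measurable_marginals) auto
  then show ?thesis by (simp only: Ball_def atMost_iff)
qed

lemma max_abs_less_AE_dyadic:
  "AE \<omega> in M.
    (\<exists>m. \<forall>n. \<forall>k\<le>2 ^ n. \<bar>W (real k / 2 ^ n) \<omega> - W 0 \<omega>\<bar> \<le> x - inverse (real (Suc m)))
      \<longleftrightarrow> max_abs W \<omega> < ereal x"
  using continuous_paths start_at_0 by eventually_elim (simp add: max_abs_less_iff_dyadic)

lemma measurable_dyadic_limit:
  "{\<omega> \<in> space M.
    \<exists>m. \<forall>n. \<forall>k\<le>2 ^ n. \<bar>W (real k / 2 ^ n) \<omega> - W 0 \<omega>\<bar> \<le> x - inverse (real (Suc m))}
      \<in> sets M"
  by (intro sets.sets_Collect_countable_Ex sets.sets_Collect_countable_All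
      measurable_dyadic_bound)

lemma \<Gamma>_eq_prob_dyadic:
  "\<Gamma> M W x = measure M {\<omega> \<in> space M.
    \<exists>m. \<forall>n. \<forall>k\<le>2 ^ n. \<bar>W (real k / 2 ^ n) \<omega> - W 0 \<omega>\<bar> \<le> x - inverse (real (Suc m))}"
  unfolding \<Gamma>_def by (rule measure_completion_AE_eq[OF measurable_dyadic_limit max_abs_less_AE_dyadic])

text \<open>
  Both limits are monotone: refining the grid shrinks the events and a larger \<open>m\<close> enlarges
  them. So \<open>\<Gamma>\<close> is expressed through probabilities that are the same for all Brownian motions.
\<close>

lemma \<Gamma>_eq_lim_dyadic:
  "\<Gamma> M W x = lim (\<lambda>m. lim (\<lambda>n. measure M
    {\<omega> \<in> space M. \<forall>k\<le>2 ^ n. \<bar>W (real k / 2 ^ n) \<omega> - W 0 \<omega>\<bar> \<le> x - inverse (real (Suc m))}))"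
proof -
  define A where "A m n =
    {\<omega> \<in> space M. \<forall>k\<le>2 ^ n. \<bar>W (real k / 2 ^ n) \<omega> - W 0 \<omega>\<bar> \<le> x - inverse (real (Suc m))}" for m n
  have A: "A m n \<in> sets M" for m n
    unfolding A_def by (rule measurable_dyadic_bound)
  \<comment> \<open>The grid point \<open>k / 2 ^ n\<close> is the point \<open>2 * k / 2 ^ Suc n\<close> of the finer grid.\<close>
  have "A m (Suc n) \<subseteq> A m n" for m n
  proof
    fix \<omega> assume \<omega>: "\<omega> \<in> A m (Suc n)"
    have "\<bar>W (real k / 2 ^ n) \<omega> - W 0 \<omega>\<bar> \<le> x - inverse (real (Suc m))" if "k \<le> 2 ^ n" for k
    proof -
      have "2 * k \<le> 2 ^ Suc n" using that by simp
      with \<omega> have "\<bar>W (real (2 * k) / 2 ^ Suc n) \<omega> - W 0 \<omega>\<bar> \<le> x - inverse (real (Suc m))"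
        unfolding A_def by blast
      then show ?thesis by simp
    qed
    with \<omega> show "\<omega> \<in> A m n" by (simp add: A_def)
  qed
  then have "decseq (A m)" for m by (rule decseq_SucI)
  then have inner: "(\<lambda>n. measure M (A m n)) \<longlonglongrightarrow> measure M (\<Inter>n. A m n)" for m
    using A by (intro finite_Lim_measure_decseq) auto
  have "A m n \<subseteq> A (Suc m) n" for m n
  proof -
    have "inverse (real (Suc (Suc m))) \<le> inverse (real (Suc m))"
      by (rule le_imp_inverse_le) auto
    then have "x - inverse (real (Suc m)) \<le> x - inverse (real (Suc (Suc m)))" by linarith
    then show ?thesis unfolding A_def by (blast intro: order_trans)
  qed
  then have "incseq (\<lambda>m. \<Inter>n. A m n)" by (intro incseq_SucI) blast
  then have outer: "(\<lambda>m. measure M (\<Inter>n. A m n)) \<longlonglongrightarrow> measure M (\<Union>m. \<Inter>n. A m n)"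
    using A by (intro finite_Lim_measure_incseq) auto
  have "\<Gamma> M W x = measure M (\<Union>m. \<Inter>n. A m n)"
    unfolding \<Gamma>_eq_prob_dyadic
    by (rule arg_cong[where f = "measure M"]) (auto simp: A_def)
  also have "\<dots> = lim (\<lambda>m. lim (\<lambda>n. measure M (A m n)))"
    by (simp only: limI[OF inner] limI[OF outer])
  finally show ?thesis by (simp only: A_def)
qed

end

text \<open>
  The two processes may live on different probability spaces, since only their common
  finite-dimensional laws enter.
\<close>

lemma \<Gamma>_unique:
  assumes "standard_brownian_motion M W" and "standard_brownian_motion M' W'"
  shows "\<Gamma> M W x = \<Gamma> M' W' x"
  by (simp only: standard_brownian_motion.\<Gamma>_eq_lim_dyadic[OF assms(1)]
      standard_brownian_motion.\<Gamma>_eq_lim_dyadic[OF assms(2)]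
      standard_brownian_motion.measure_dyadic_bound[OF assms(1)]
      standard_brownian_motion.measure_dyadic_bound[OF assms(2)])

section \<open>Brownian scaling\<close>

context standard_brownian_motion
begin

lemma brownian_scaling:
  assumes c: "c > 0"
  shows "standard_brownian_motion M (\<lambda>s \<omega>. W (c * s) \<omega> / sqrt c)"
proof (unfold_locales, goal_cases)
  case (1 s)
  then show ?case
    using c measurable_marginals[of "c * s"] by (intro borel_measurable_divide) auto
next
  case 2
  show ?case using start_at_0 by eventually_elim simp
next
  case (3 u n)
  then have "indep_vars (\<lambda>_. borel) (\<lambda>i \<omega>. W (c * u (Suc i)) \<omega> - W (c * u i) \<omega>) {..<n}"
    using c by (intro independent_increments) auto
  then have "indep_vars (\<lambda>_. borel)
      (\<lambda>i \<omega>. (W (c * u (Suc i)) \<omega> - W (c * u i) \<omega>) / sqrt c) {..<n}"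
    by (rule indep_vars_compose2[where Y = "\<lambda>_ x. x / sqrt c"]) simp
  then show ?case by (simp add: diff_divide_distrib)
next
  case (4 r s)
  have "distributed M lborel (\<lambda>\<omega>. W (c * s) \<omega> - W (c * r) \<omega>)
      (normal_density 0 (sqrt (c * s - c * r)))"
    using 4 c by (intro gaussian_increments) auto
  then have "distributed M lborel (\<lambda>\<omega>. 0 + (1 / sqrt c) * (W (c * s) \<omega> - W (c * r) \<omega>))
      (normal_density (0 + (1 / sqrt c) * 0) (\<bar>1 / sqrt c\<bar> * sqrt (c * s - c * r)))"
    using 4 c by (intro normal_density_affine) auto
  moreover have "\<bar>1 / sqrt c\<bar> * sqrt (c * s - c * r) = sqrt (s - r)"
    using c by (simp add: right_diff_distrib[symmetric] real_sqrt_mult)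
  ultimately show ?case by (simp add: diff_divide_distrib)
next
  case 5
  show ?case
    using continuous_paths
  proof eventually_elim
    case (elim \<omega>)
    show ?case
      using c by (intro continuous_intros continuous_on_compose2[OF elim]) auto
  qed
qed

section \<open>The exit time and the rescaled maximum\<close>

lemma AE_abs_marginal_neq:
  assumes t: "t > 0"
  shows "AE \<omega> in M. \<bar>W t \<omega>\<bar> \<noteq> a"
proof -
  have D: "distributed M lborel (\<lambda>\<omega>. W t \<omega> - W 0 \<omega>) (normal_density 0 (sqrt (t - 0)))"
    using t by (intro gaussian_increments) auto
  have "AE x in lborel. x \<notin> {a, - a}"
    by (intro AE_not_in finite_imp_null_set_lborel) auto
  then have "AE x in lborel. normal_density 0 (sqrt (t - 0)) x > 0 \<longrightarrow> x \<notin> {a, - a}"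
    by eventually_elim simp
  then have "AE x in density lborel (normal_density 0 (sqrt (t - 0))). x \<notin> {a, - a}"
    by (subst AE_density) auto
  then have "AE x in distr M lborel (\<lambda>\<omega>. W t \<omega> - W 0 \<omega>). x \<notin> {a, - a}"
    by (simp only: distributed_distr_eq_density[OF D])
  then have "AE \<omega> in M. W t \<omega> - W 0 \<omega> \<notin> {a, - a}"
    using distributed_measurable[OF D] by (subst (asm) AE_distr_iff) auto
  with start_at_0 show ?thesis
    by eventually_elim auto
qed

lemma \<Phi>_eq_one_minus_\<Gamma>_rescaled:
  assumes t: "t > 0"
  shows "\<Phi> M W t = 1 - \<Gamma> M (\<lambda>s \<omega>. W (t * s) \<omega> / sqrt t) (1 / sqrt t)"
proof -
  let ?B = "\<lambda>s \<omega>. W (t * s) \<omega> / sqrt t"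
  interpret B: standard_brownian_motion M ?B using t by (rule brownian_scaling)
  define E where "E \<omega> \<longleftrightarrow> (\<exists>m. \<forall>n. \<forall>k\<le>2 ^ n.
    \<bar>?B (real k / 2 ^ n) \<omega> - ?B 0 \<omega>\<bar> \<le> 1 / sqrt t - inverse (real (Suc m)))" for \<omega>
  have E: "{\<omega> \<in> space M. E \<omega>} \<in> sets M"
    unfolding E_def by (rule B.measurable_dyadic_limit)
  have "AE \<omega> in M. E \<omega> \<longleftrightarrow> max_abs ?B \<omega> < ereal (1 / sqrt t)"
    unfolding E_def by (rule B.max_abs_less_AE_dyadic)
  then have "AE \<omega> in M. \<not> E \<omega> \<longleftrightarrow> exit_time W \<omega> < ereal t"
    using continuous_paths start_at_0 AE_abs_marginal_neq[OF t, of 1]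
  proof eventually_elim
    case (elim \<omega>)
    then show ?case using exit_time_less_iff_max_abs_rescaled[of W \<omega> t] t by blast
  qed
  then have "\<Phi> M W t = measure M {\<omega> \<in> space M. \<not> E \<omega>}"
    unfolding \<Phi>_def by (intro measure_completion_AE_eq sets.sets_Collect_neg E)
  also have "\<dots> = 1 - measure M {\<omega> \<in> space M. E \<omega>}"
    using E by (rule prob_neg)
  also have "measure M {\<omega> \<in> space M. E \<omega>} = \<Gamma> M ?B (1 / sqrt t)"
    unfolding E_def by (rule B.\<Gamma>_eq_prob_dyadic[symmetric])
  finally show ?thesis .
qed

end

theorem proposition4:
  fixes M :: "'a measure" and W :: "real \<Rightarrow> 'a \<Rightarrow> real" and t :: real
  assumes "standard_brownian_motion M W" and "t > 0"
  shows "\<Phi> M W t = 1 - \<Gamma> M W (1 / sqrt t)"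
proof -
  interpret standard_brownian_motion M W by fact
  have "\<Phi> M W t = 1 - \<Gamma> M (\<lambda>s \<omega>. W (t * s) \<omega> / sqrt t) (1 / sqrt t)"
    using \<open>t > 0\<close> by (rule \<Phi>_eq_one_minus_\<Gamma>_rescaled)
  also have "\<Gamma> M (\<lambda>s \<omega>. W (t * s) \<omega> / sqrt t) (1 / sqrt t) = \<Gamma> M W (1 / sqrt t)"
    using brownian_scaling[OF \<open>t > 0\<close>] assms(1) by (rule \<Gamma>_unique)
  finally show ?thesis .
qed

end
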